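(* Let $T$ be an out-quadrangular tournament and let $v\in V(T)$. Let $W$ be the subtournament of $T$ induced on the vertex set $O(v)$. Then $W$ contains no vertex of out-degree $1$ (out-degree computed in $W$).
   Context: A tournament $T$ is a loopless digraph in which for each pair of distinct vertices exactly one of $(u,v)$, $(v,u)$ is an arc; $u\rightarrow v$ means $(u,v)$ is an arc. $O(v)=\{u:v\rightarrow u\}$. A digraph is out-quadrangular if $|O(u)\cap O(v)|\neq 1$ for all distinct vertices $u,v$. *)

theory Defs
  imports "Graph_Theory.Digraph_Component"
begin

(* Finiteness is not required; hence not the library locale digraph. *)
locale tournament = loopfree_digraph + nomulti_digraph +
  assumes exactly_one_arc:
    "\<lbrakk>u \<in> verts G; v \<in> verts G; u \<noteq> v\<rbrakk>
      \<Longrightarrow> (u \<rightarrow> v \<and> \<not> v \<rightarrow> u) \<or> (v \<rightarrow> u \<and> \<not> u \<rightarrow> v)"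

definition out_neighbours :: "('a, 'b) pre_digraph \<Rightarrow> 'a \<Rightarrow> 'a set" where
  "out_neighbours G v = {u \<in> verts G. v \<rightarrow>\<^bsub>G\<^esub> u}"

(* An infinite intersection has card 0, so it satisfies the condition, as it should. *)
definition out_quadrangular :: "('a, 'b) pre_digraph \<Rightarrow> bool" where
  "out_quadrangular G \<longleftrightarrow>
    (\<forall>u \<in> verts G. \<forall>v \<in> verts G.
      u \<noteq> v \<longrightarrow> card (out_neighbours G u \<inter> out_neighbours G v) \<noteq> 1)"

end

theory Submission
  imports Defs
begin

text \<open>For a vertex \<open>w\<close> of \<open>W\<close>, the arcs of \<open>W\<close> leaving
  \<open>w\<close> lead exactly to the common out-neighbours of \<open>v\<close> and
  \<open>w\<close> in \<open>T\<close>. So the out-degree of \<open>w\<close> in \<open>W\<close> is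
  the size of O(v) \<inter> O(w), which out-quadrangularity forbids to be 1 as soon as
  \<open>v\<close> and \<open>w\<close> are distinct.\<close>

lemma out_degree_induce_subgraph_out_neighbours:
  assumes "nomulti_digraph G" and "w \<in> out_neighbours G v"
  shows "out_degree (G \<restriction> out_neighbours G v) w
    = card (out_neighbours G v \<inter> out_neighbours G w)"
proof -
  interpret nomulti_digraph G by fact
  let ?A = "out_arcs (G \<restriction> out_neighbours G v) w"
  \<comment> \<open>The tail \<open>w\<close> already lies in the inducing set, so only the
    condition on the head remains.\<close>
  have A: "?A = {e \<in> arcs G. tail G e = w \<and> head G e \<in> out_neighbours G v}"
    using assms(2) by (auto simp: out_arcs_def induce_subgraph_def)
  \<comment> \<open>Without parallel arcs, an arc leaving \<open>w\<close> is determined by its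
    head, so counting arcs amounts to counting heads. An injection preserves \<open>card\<close> for
    infinite sets too, where both sides are 0.\<close>
  have "inj_on (head G) ?A"
    unfolding A by (auto intro!: inj_onI no_multi_arcs simp: arc_to_ends_def)
  moreover have "head G ` ?A = out_neighbours G v \<inter> out_neighbours G w"
    unfolding A by (force simp: out_neighbours_def arcs_ends_def arc_to_ends_def)
  ultimately show ?thesis
    unfolding out_degree_def by (metis card_image)
qed

theorem theorem9:
  fixes T W :: "('a, 'b) pre_digraph" and v :: 'a
  assumes "tournament T"
    and "out_quadrangular T"
    and "v \<in> verts T"
    and "W = T \<restriction> out_neighbours T v"
  shows "\<not> (\<exists>w \<in> verts W. out_degree W w = 1)"
proof
  assume "\<exists>w \<in> verts W. out_degree W w = 1"
  then obtain w where w: "w \<in> out_neighbours T v" and deg: "out_degree W w = 1"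
    using assms(4) by auto
  interpret tournament T by fact
  \<comment> \<open>Distinctness holds because \<open>v\<close> dominates \<open>w\<close> and
    \<open>T\<close> has no loops.\<close>
  have "w \<in> verts T" and "v \<noteq> w"
    using w by (auto simp: out_neighbours_def dest: adj_not_same)
  then have "card (out_neighbours T v \<inter> out_neighbours T w) \<noteq> 1"
    using assms(2,3) by (simp add: out_quadrangular_def)
  then show False
    using deg out_degree_induce_subgraph_out_neighbours[OF nomulti_digraph_axioms w] assms(4)
    by simp
qed

end
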